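(* Let $k,m\ge3$ be odd integers, $0\le\alpha\le1$, and let $T_{k,m,C_{4}}=C_k\square C_m$ be the $C_4$ nanotorus. Then the generalized distance spectrum of $T_{k,m,C_{4}}$ consists of the following numbers: (1) $\frac{(m+k)(mk-1)}{4}$; (2) $-\frac{m(1-\alpha)}{4}\sec^{2}\!\left(\frac{\pi j}{2k}\right)+\frac{\alpha(m+k)(mk-1)}{4}$ for $j\in\{1,\ldots,k-1\}$ even; (3) $-\frac{m(1-\alpha)}{4}\csc^{2}\!\left(\frac{\pi r}{2k}\right)+\frac{\alpha(m+k)(mk-1)}{4}$ for $r\in\{1,\ldots,k-1\}$ odd; (4) $-\frac{k(1-\alpha)}{4}\sec^{2}\!\left(\frac{\pi t}{2m}\right)+\frac{\alpha(m+k)(mk-1)}{4}$ for $t\in\{1,\ldots,m-1\}$ even; (5) $-\frac{k(1-\alpha)}{4}\csc^{2}\!\left(\frac{\pi l}{2m}\right)+\frac{\alpha(m+k)(mk-1)}{4}$ for $l\in\{1,\ldots,m-1\}$ odd; (6) $\frac{\alpha(m+k)(mk-1)}{4}$, with multiplicity $(k-1)(m-1)$.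
   Context: $C_k$ is the cycle on $k$ vertices. $G\square H$ is the Cartesian product: vertex set $V(G)\times V(H)$, with $(u_1,v_1)\sim(u_2,v_2)$ iff $u_1=u_2$ and $v_1v_2\in E(H)$, or $v_1=v_2$ and $u_1u_2\in E(G)$. The generalized distance matrix is $\mathcal{D}_\alpha=\alpha\,Tr+(1-\alpha)\mathcal{D}$, where $\mathcal{D}$ is the distance matrix and $Tr$ the diagonal matrix of vertex transmissions $Tr(u)=\sum_v d(u,v)$; its multiset of eigenvalues is the generalized distance spectrum. *)

theory Defs
  imports
    "Jordan_Normal_Form.Char_Poly"
    "Graph_Theory.Graph_Theory"
    Complex_Main
begin

text \<open>
  Finite simple graphs are the \<open>pair_graph\<close>s of the Graph_Theory entry, i.e. loop-free digraphs
  with a symmetric arc relation.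
\<close>

definition cycle_graph :: "nat \<Rightarrow> nat pair_pre_digraph" where
  "cycle_graph k = \<lparr> pverts = {0..<k},
     parcs = {(u, v). u < k \<and> v < k \<and> (v = Suc u mod k \<or> u = Suc v mod k)} \<rparr>"

definition cartesian_product ::
    "'a pair_pre_digraph \<Rightarrow> 'b pair_pre_digraph \<Rightarrow> ('a \<times> 'b) pair_pre_digraph"
    (infixl \<open>\<box>\<close> 70) where
  "G \<box> H = \<lparr> pverts = pverts G \<times> pverts H,
     parcs = {((u1, v1), (u2, v2)) | u1 v1 u2 v2.
                (u1 = u2 \<and> u1 \<in> pverts G \<and> (v1, v2) \<in> parcs H) \<or>
                (v1 = v2 \<and> v1 \<in> pverts H \<and> (u1, u2) \<in> parcs G)} \<rparr>"

definition c4_nanotorus :: "nat \<Rightarrow> nat \<Rightarrow> (nat \<times> nat) pair_pre_digraph" where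
  "c4_nanotorus k m = cycle_graph k \<box> cycle_graph m"

text \<open>
  The distance is the infimum of the lengths of all walks, i.e. the cost of a shortest path for
  unit weights. It is infinite for disconnected vertices, and such a pair would be sent to \<open>0\<close>
  by \<open>real_of_ereal\<close>; the notions below are meant for connected graphs only.
\<close>

definition graph_dist :: "'a pair_pre_digraph \<Rightarrow> 'a \<Rightarrow> 'a \<Rightarrow> real" where
  "graph_dist G u v = real_of_ereal (wf_digraph.\<mu> (with_proj G) (\<lambda>_. 1) u v)"

definition transmission :: "'a pair_pre_digraph \<Rightarrow> 'a \<Rightarrow> real" where
  "transmission G u = (\<Sum>v\<in>pverts G. graph_dist G u v)"

text \<open>
  The list \<open>vs\<close> enumerates the vertices without repetition and fixes the order of rows and columns.
\<close>

definition distance_mat :: "'a pair_pre_digraph \<Rightarrow> 'a list \<Rightarrow> real mat" where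
  "distance_mat G vs =
     mat (length vs) (length vs) (\<lambda>(i, j). graph_dist G (vs ! i) (vs ! j))"

definition transmission_mat :: "'a pair_pre_digraph \<Rightarrow> 'a list \<Rightarrow> real mat" where
  "transmission_mat G vs =
     mat (length vs) (length vs) (\<lambda>(i, j). if i = j then transmission G (vs ! i) else 0)"

definition gen_distance_mat :: "real \<Rightarrow> 'a pair_pre_digraph \<Rightarrow> 'a list \<Rightarrow> real mat" where
  "gen_distance_mat \<alpha> G vs =
     \<alpha> \<cdot>\<^sub>m transmission_mat G vs + (1 - \<alpha>) \<cdot>\<^sub>m distance_mat G vs"

text \<open>
  Eigenvalues are counted with algebraic multiplicity. For an undirected graph the matrix is real
  symmetric, so the real roots of the characteristic polynomial are all of its eigenvalues.
\<close>

definition gen_distance_spectrum ::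
    "real \<Rightarrow> 'a pair_pre_digraph \<Rightarrow> 'a list \<Rightarrow> real multiset" where
  "gen_distance_spectrum \<alpha> G vs = proots (char_poly (gen_distance_mat \<alpha> G vs))"

definition sec :: "real \<Rightarrow> real" where
  "sec x = 1 / cos x"

definition csc :: "real \<Rightarrow> real" where
  "csc x = 1 / sin x"

lemma pair_graph_cycle_graph:
  assumes "k \<ge> 3"
  shows "pair_graph (cycle_graph k)"
proof
  have "parcs (cycle_graph k) \<subseteq> {0..<k} \<times> {0..<k}"
    by (auto simp: cycle_graph_def)
  then show "finite (parcs (cycle_graph k))"
    by (rule finite_subset) simp
  show "symmetric (with_proj (cycle_graph k))"
    by (auto simp: symmetric_def sym_def cycle_graph_def)
  show "fst e \<noteq> snd e" if "e \<in> parcs (cycle_graph k)" for e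
    using that assms by (auto simp: cycle_graph_def mod_Suc split: if_splits)
qed (auto simp: cycle_graph_def)

lemma pair_graph_cartesian_product:
  assumes "pair_graph G" "pair_graph H"
  shows "pair_graph (G \<box> H)"
proof -
  interpret G: pair_graph G by fact
  interpret H: pair_graph H by fact
  have sG: "(v, u) \<in> parcs G" if "(u, v) \<in> parcs G" for u v
    using that G.pair_sym_arcs by (simp add: symmetric_def sym_def)
  have sH: "(v, u) \<in> parcs H" if "(u, v) \<in> parcs H" for u v
    using that H.pair_sym_arcs by (simp add: symmetric_def sym_def)
  show ?thesis
  proof
    have "parcs (G \<box> H) \<subseteq> (pverts G \<times> pverts H) \<times> (pverts G \<times> pverts H)"
      by (auto simp: cartesian_product_def dest: G.wellformed' H.wellformed')
    then show "finite (parcs (G \<box> H))"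
      by (rule finite_subset) (auto simp: G.pair_finite_verts H.pair_finite_verts)
    show "symmetric (with_proj (G \<box> H))"
      by (auto simp: symmetric_def sym_def cartesian_product_def dest: sG sH)
    show "fst e \<noteq> snd e" if "e \<in> parcs (G \<box> H)" for e
      using that by (auto simp: cartesian_product_def dest: G.pair_no_loops H.pair_no_loops)
  qed (auto simp: cartesian_product_def G.pair_finite_verts H.pair_finite_verts
        dest: G.wellformed' H.wellformed')
qed

end

theory Submission
  imports Defs
begin

text \<open>
  The distance in a Cartesian product is the sum of the distances in the factors, so the distance
  matrix of \<open>C\<^sub>k \<box> C\<^sub>m\<close> is \<open>D\<^sub>k \<otimes> J + J \<otimes> D\<^sub>m\<close> with \<open>J\<close> the all-ones matrix. A symmetric
  circulant matrix is diagonalised over the reals by the Hartley matrix, whose entries are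
  \<open>cas (2\<pi>uv/k)\<close> with \<open>cas = cos + sin\<close> and whose square is \<open>k\<close> times the identity; its columns
  other than the constant one are annihilated by \<open>J\<close>. The transmission is constant, so products of
  Hartley columns diagonalise the generalized distance matrix as well. The eigenvalues of \<open>D\<^sub>k\<close> for odd
  \<open>k\<close> come from the closed form of \<open>\<Sum>d\<le>n. d cos (2d\<phi>)\<close>.
\<close>

section \<open>Spectrum of a matrix from a basis of eigenvectors\<close>

text \<open>By \<open>orth\<close> the matrix of \<open>P\<close> has its own multiple by
  \<open>1 / c\<close> as inverse, and \<open>eig\<close> then makes the matrix of \<open>A\<close>
  similar to a diagonal one. Sums run over the set of vertices, so the order chosen in
  \<open>vs\<close> disappears from the hypotheses.\<close>

lemma proots_char_poly_eqI:
  fixes A :: "'a \<Rightarrow> 'a \<Rightarrow> real" and P :: "'a \<Rightarrow> 'a \<Rightarrow> real"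
  assumes vs: "distinct vs" and c: "c \<noteq> 0"
    and eig: "\<And>u v. u \<in> set vs \<Longrightarrow> v \<in> set vs \<Longrightarrow> (\<Sum>w\<in>set vs. A u w * P w v) = \<mu> v * P u v"
    and orth: "\<And>u v. u \<in> set vs \<Longrightarrow> v \<in> set vs \<Longrightarrow>
      (\<Sum>w\<in>set vs. P u w * P w v) = (if u = v then c else 0)"
  shows "proots (char_poly (mat (length vs) (length vs) (\<lambda>(i, j). A (vs ! i) (vs ! j)))) =
    image_mset \<mu> (mset_set (set vs))"
proof -
  define n where "n = length vs"
  define M where "M = mat n n (\<lambda>(i, j). A (vs ! i) (vs ! j))"
  define P' where "P' = mat n n (\<lambda>(i, j). P (vs ! i) (vs ! j))"
  define Q where "Q = mat n n (\<lambda>(i, j). P (vs ! i) (vs ! j) / c)"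
  define D where "D = mat n n (\<lambda>(i, j). if i = j then \<mu> (vs ! i) else 0)"
  have carr: "M \<in> carrier_mat n n" "P' \<in> carrier_mat n n" "Q \<in> carrier_mat n n" "D \<in> carrier_mat n n"
    by (simp_all add: M_def P'_def Q_def D_def)
  have reidx: "(\<Sum>i<n. f (vs ! i)) = sum f (set vs)" for f :: "'a \<Rightarrow> real"
    using sum.reindex_bij_betw[OF bij_betw_nth[OF vs, of "{..<n}" "set vs"]] by (simp add: n_def)
  have PQ: "P' * Q = 1\<^sub>m n"
  proof (rule eq_matI)
    fix i j assume "i < dim_row (1\<^sub>m n :: real mat)" "j < dim_col (1\<^sub>m n :: real mat)"
    then have ij: "i < n" "j < n" by simp_all
    have "(P' * Q) $$ (i, j) = (\<Sum>l<n. P (vs ! i) (vs ! l) * P (vs ! l) (vs ! j) / c)"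
      using ij by (simp add: P'_def Q_def scalar_prod_def atLeast0LessThan)
    also have "\<dots> = (\<Sum>w\<in>set vs. P (vs ! i) w * P w (vs ! j)) / c"
      by (simp add: reidx[symmetric] sum_divide_distrib)
    also have "\<dots> = 1\<^sub>m n $$ (i, j)"
      using ij vs c by (simp add: orth n_def nth_eq_iff_index_eq)
    finally show "(P' * Q) $$ (i, j) = 1\<^sub>m n $$ (i, j)" .
  qed (simp_all add: P'_def Q_def)
  have MP: "M * P' = P' * D"
  proof (rule eq_matI)
    fix i j assume "i < dim_row (P' * D)" "j < dim_col (P' * D)"
    then have ij: "i < n" "j < n" by (simp_all add: P'_def D_def)
    have "(M * P') $$ (i, j) = (\<Sum>l<n. A (vs ! i) (vs ! l) * P (vs ! l) (vs ! j))"
      using ij by (simp add: P'_def M_def scalar_prod_def atLeast0LessThan)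
    also have "\<dots> = \<mu> (vs ! j) * P (vs ! i) (vs ! j)"
      using ij reidx[of "\<lambda>w. A (vs ! i) w * P w (vs ! j)"] by (simp add: eig n_def)
    also have "\<dots> = (P' * D) $$ (i, j)"
      using ij by (simp add: P'_def D_def scalar_prod_def if_distrib sum.delta cong: if_cong)
    finally show "(M * P') $$ (i, j) = (P' * D) $$ (i, j)" .
  qed (simp_all add: P'_def D_def M_def)
  have "M = M * (P' * Q)"
    using carr by (simp add: PQ)
  also have "\<dots> = P' * D * Q"
    using carr by (simp add: MP[symmetric] assoc_mult_mat[of _ n n _ n _ n])
  finally have "similar_mat M D"
    using mat_mult_left_right_inverse[OF carr(2,3) PQ] PQ carr by (intro similar_matI) auto
  then have "char_poly M = char_poly D" by (rule char_poly_similar)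
  also have "\<dots> = (\<Prod>a\<leftarrow>diag_mat D. [:- a, 1:])"
    by (rule char_poly_upper_triangular[of _ n]) (auto simp: D_def upper_triangular_def)
  also have "diag_mat D = map \<mu> vs"
    by (rule nth_equalityI) (auto simp: diag_mat_def D_def n_def)
  finally have "char_poly M = (\<Prod>x\<leftarrow>vs. [:- \<mu> x, 1:])"
    by (simp add: comp_def)
  moreover have "proots (\<Prod>x\<leftarrow>xs. [:- \<mu> x, 1:]) = image_mset \<mu> (mset xs)" for xs
  proof (induction xs)
    case (Cons x xs)
    have "(\<Prod>x\<leftarrow>xs. [:- \<mu> x, 1:]) \<noteq> 0" by (auto simp: prod_list_zero_iff)
    then have "proots ([:- \<mu> x, 1:] * (\<Prod>x\<leftarrow>xs. [:- \<mu> x, 1:])) =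
        proots [:- \<mu> x, 1:] + proots (\<Prod>x\<leftarrow>xs. [:- \<mu> x, 1:])"
      by (intro proots_mult) auto
    then show ?case by (simp only: Cons.IH list.map prod_list.Cons proots_linear_factor) simp
  qed simp
  ultimately show ?thesis
    by (simp add: M_def n_def mset_set_set[OF vs])
qed

section \<open>Distances in cycles and in their product\<close>

text \<open>A certificate for a distance function. By \<open>lip\<close> no walk to \<open>v\<close>
  is shorter than \<open>d u v\<close>; by \<open>desc\<close> a walk of exactly that length is
  found by decreasing \<open>d\<close> one arc at a time.\<close>

lemma graph_dist_eqI:
  fixes d :: "'a \<Rightarrow> 'a \<Rightarrow> nat"
  assumes "pair_wf_digraph G"
    and refl: "\<And>v. d v v = 0"
    and lip: "\<And>u w v. (u, w) \<in> parcs G \<Longrightarrow> v \<in> pverts G \<Longrightarrow> d u v \<le> Suc (d w v)"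
    and desc: "\<And>u v. u \<in> pverts G \<Longrightarrow> v \<in> pverts G \<Longrightarrow> u \<noteq> v \<Longrightarrow>
      \<exists>w. (u, w) \<in> parcs G \<and> d u v = Suc (d w v)"
    and uv: "u \<in> pverts G" "v \<in> pverts G"
  shows "graph_dist G u v = real (d u v)"
proof -
  interpret pair_wf_digraph G by fact
  have lower: "real (d u v) \<le> awalk_cost (\<lambda>_. 1) p" if "awalk u p v" for u p
    using that
  proof (induction p arbitrary: u)
    case Nil
    then show ?case by (simp add: awalk_Nil_iff refl)
  next
    case (Cons e p)
    have "e \<in> parcs G" "u = fst e" "awalk (snd e) p v"
      using Cons.prems by (auto simp: awalk_Cons_iff)
    moreover have "d (fst e) v \<le> Suc (d (snd e) v)"
      using lip \<open>e \<in> parcs G\<close> uv(2) by simp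
    ultimately show ?case
      using Cons.IH[of "snd e"] by simp
  qed
  have upper: "\<exists>p. awalk u p v \<and> awalk_cost (\<lambda>_. 1) p = real n" if "d u v = n" "u \<in> pverts G" for u n
    using that
  proof (induction n arbitrary: u)
    case 0
    \<comment> \<open>For \<open>u\<close> different from \<open>v\<close>, \<open>desc\<close>
      would make \<open>d u v\<close> a successor.\<close>
    then have "u = v" using desc[OF _ uv(2)] by fastforce
    then show ?case using 0 by (intro exI[of _ "[]"]) (simp add: awalk_Nil_iff)
  next
    case (Suc n)
    then have "u \<noteq> v" using refl by auto
    then obtain w where w: "(u, w) \<in> parcs G" "d u v = Suc (d w v)"
      using desc Suc.prems uv by blast
    then obtain p where "awalk w p v" "awalk_cost (\<lambda>_. 1) p = real n"
      using Suc in_arcsD2[of u w] by auto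
    then show ?case using w by (intro exI[of _ "(u, w) # p"]) (simp add: awalk_Cons_iff)
  qed
  obtain p where "awalk u p v" "awalk_cost (\<lambda>_. 1) p = real (d u v)"
    using upper[OF HOL.refl uv(1)] by blast
  then have "\<mu> (\<lambda>_. 1) u v = ereal (real (d u v))"
    unfolding \<mu>_def using lower by (intro antisym INF_greatest INF_lower2[of p]) auto
  then show ?thesis by (simp add: graph_dist_def)
qed

text \<open>Subtraction on \<open>nat\<close> is truncated, so one of the two differences is
  \<open>0\<close> and \<open>d\<close> is the absolute difference of the labels.\<close>

definition cycle_dist :: "nat \<Rightarrow> nat \<Rightarrow> nat \<Rightarrow> nat" where
  "cycle_dist k u v = (let d = (u - v) + (v - u) in min d (k - d))"

lemma cycle_dist_same [simp]: "cycle_dist k u u = 0"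
  by (simp add: cycle_dist_def)

text \<open>Replaces \<open>mod\<close> by cases, which linear arithmetic can handle.\<close>

lemma cycle_arc_iff:
  assumes "k \<ge> 3"
  shows "(u, w) \<in> parcs (cycle_graph k) \<longleftrightarrow> u < k \<and> w < k \<and>
    (w = Suc u \<or> u = Suc w \<or> (Suc u = k \<and> w = 0) \<or> (Suc w = k \<and> u = 0))"
  using assms by (auto simp: cycle_graph_def mod_Suc)

lemma cycle_dist_Lipschitz:
  assumes "k \<ge> 3" "(u, w) \<in> parcs (cycle_graph k)" "v < k"
  shows "cycle_dist k u v \<le> Suc (cycle_dist k w v)"
  using assms(2,3) unfolding cycle_arc_iff[OF assms(1)] cycle_dist_def Let_def by linarith

lemma cycle_dist_le:
  assumes "u \<le> v"
  shows "cycle_dist k u v = min (v - u) (k - (v - u))" "cycle_dist k v u = min (v - u) (k - (v - u))"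
  using assms by (simp_all add: cycle_dist_def)

text \<open>One moves from \<open>u\<close> along a shorter of the two arcs to \<open>v\<close>. The
  six cases record which arc that is and whether the move wraps around between \<open>k - 1\<close>
  and \<open>0\<close>.\<close>

lemma cycle_dist_descent:
  assumes k: "k \<ge> 3" and uv: "u < k" "v < k" "u \<noteq> v"
  shows "\<exists>w. (u, w) \<in> parcs (cycle_graph k) \<and> cycle_dist k u v = Suc (cycle_dist k w v)"
proof -
  define up where "up = (if Suc u = k then 0 else Suc u)"
  define down where "down = (if u = 0 then k - 1 else u - 1)"
  have arcs: "(u, up) \<in> parcs (cycle_graph k)" "(u, down) \<in> parcs (cycle_graph k)"
    using k uv by (auto simp: cycle_arc_iff up_def down_def)
  consider "u < v" "2 * v \<le> k + 2 * u" | "u < v" "2 * v > k + 2 * u" "u = 0"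
    | "u < v" "2 * v > k + 2 * u" "u > 0"
    | "v < u" "2 * u \<le> k + 2 * v" | "v < u" "2 * u > k + 2 * v" "Suc u = k"
    | "v < u" "2 * u > k + 2 * v" "Suc u < k"
    using uv by linarith
  then have "cycle_dist k u v = Suc (cycle_dist k up v) \<or> cycle_dist k u v = Suc (cycle_dist k down v)"
  proof cases
    case 1
    then have "up = Suc u" using uv by (simp add: up_def)
    moreover have "cycle_dist k u v = v - u"
      using 1 uv cycle_dist_le(1)[of u v k] by linarith
    moreover have "cycle_dist k (Suc u) v = v - Suc u"
      using 1 uv cycle_dist_le(1)[of "Suc u" v k] by linarith
    moreover have "v - u = Suc (v - Suc u)"
      using 1 uv by linarith
    ultimately show ?thesis by simp
  next
    case 2
    then have "down = k - 1" using uv by (simp add: down_def)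
    moreover have "cycle_dist k u v = k - v"
      using 2 uv cycle_dist_le(1)[of u v k] by linarith
    moreover have "cycle_dist k (k - 1) v = k - 1 - v"
      using 2 uv cycle_dist_le(2)[of v "k - 1" k] by linarith
    moreover have "k - v = Suc (k - 1 - v)"
      using 2 uv by linarith
    ultimately show ?thesis by simp
  next
    case 3
    then have "down = u - 1" using uv by (simp add: down_def)
    moreover have "cycle_dist k u v = k - (v - u)"
      using 3 uv cycle_dist_le(1)[of u v k] by linarith
    moreover have "cycle_dist k (u - 1) v = k - (v - (u - 1))"
      using 3 uv cycle_dist_le(1)[of "u - 1" v k] by linarith
    moreover have "k - (v - u) = Suc (k - (v - (u - 1)))"
      using 3 uv by linarith
    ultimately show ?thesis by simp
  next
    case 4
    then have "down = u - 1" using uv by (simp add: down_def)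
    moreover have "cycle_dist k u v = u - v"
      using 4 uv cycle_dist_le(2)[of v u k] by linarith
    moreover have "cycle_dist k (u - 1) v = u - 1 - v"
      using 4 uv cycle_dist_le(2)[of v "u - 1" k] by linarith
    moreover have "u - v = Suc (u - 1 - v)"
      using 4 uv by linarith
    ultimately show ?thesis by simp
  next
    case 5
    then have "up = 0" using uv by (simp add: up_def)
    moreover have "cycle_dist k u v = Suc v"
      using 5 uv cycle_dist_le(2)[of v u k] by linarith
    moreover have "cycle_dist k 0 v = v"
      using 5 uv cycle_dist_le(1)[of 0 v k] by linarith
    moreover have "Suc v = Suc v"
      using 5 uv by linarith
    ultimately show ?thesis by simp
  next
    case 6
    then have "up = Suc u" using uv by (simp add: up_def)
    moreover have "cycle_dist k u v = k - (u - v)"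
      using 6 uv cycle_dist_le(2)[of v u k] by linarith
    moreover have "cycle_dist k (Suc u) v = k - (Suc u - v)"
      using 6 uv cycle_dist_le(2)[of v "Suc u" k] by linarith
    moreover have "k - (u - v) = Suc (k - (Suc u - v))"
      using 6 uv by linarith
    ultimately show ?thesis by simp
  qed
  with arcs show ?thesis by blast
qed

text \<open>An arc of the product moves in one coordinate only, which gives the Lipschitz bound. For
  the descent, the first coordinate is moved until it agrees with its target, then the
  second.\<close>

lemma graph_dist_nanotorus:
  assumes k: "k \<ge> 3" and m: "m \<ge> 3" and "u1 < k" "u2 < m" "v1 < k" "v2 < m"
  shows "graph_dist (c4_nanotorus k m) (u1, u2) (v1, v2) =
    real (cycle_dist k u1 v1) + real (cycle_dist m u2 v2)"
proof -
  define d where "d = (\<lambda>u v. cycle_dist k (fst u) (fst v) + cycle_dist m (snd u) (snd v))"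
  have verts: "pverts (c4_nanotorus k m) = {0..<k} \<times> {0..<m}"
    by (simp add: c4_nanotorus_def cartesian_product_def cycle_graph_def)
  have arcs: "((a, b), (a', b')) \<in> parcs (c4_nanotorus k m) \<longleftrightarrow>
      (a = a' \<and> a < k \<and> (b, b') \<in> parcs (cycle_graph m)) \<or>
      (b = b' \<and> b < m \<and> (a, a') \<in> parcs (cycle_graph k))" for a b a' b'
    by (auto simp: c4_nanotorus_def cartesian_product_def cycle_graph_def)
  have "pair_graph (c4_nanotorus k m)"
    unfolding c4_nanotorus_def
    by (intro pair_graph_cartesian_product pair_graph_cycle_graph k m)
  then interpret pair_graph "c4_nanotorus k m" .
  have "graph_dist (c4_nanotorus k m) (u1, u2) (v1, v2) = real (d (u1, u2) (v1, v2))"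
  proof (rule graph_dist_eqI)
    show "pair_wf_digraph (c4_nanotorus k m)" by unfold_locales
    show "d u v \<le> Suc (d w v)"
      if "(u, w) \<in> parcs (c4_nanotorus k m)" "v \<in> pverts (c4_nanotorus k m)" for u w v
      using that cycle_dist_Lipschitz[OF k, of "fst u" "fst w" "fst v"]
        cycle_dist_Lipschitz[OF m, of "snd u" "snd w" "snd v"]
      by (cases u; cases w; cases v) (auto simp: arcs verts d_def)
    show "\<exists>w. (u, w) \<in> parcs (c4_nanotorus k m) \<and> d u v = Suc (d w v)"
      if "u \<in> pverts (c4_nanotorus k m)" "v \<in> pverts (c4_nanotorus k m)" "u \<noteq> v" for u v
    proof -
      obtain a b a' b' where uv: "u = (a, b)" "v = (a', b')" by fastforce
      have lt: "a < k" "b < m" "a' < k" "b' < m" using that by (auto simp: uv verts)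
      show ?thesis
      proof (cases "a = a'")
        case False
        with cycle_dist_descent[OF k lt(1,3)] obtain w
          where "(a, w) \<in> parcs (cycle_graph k)" "cycle_dist k a a' = Suc (cycle_dist k w a')"
          by blast
        then show ?thesis using lt by (intro exI[of _ "(w, b)"]) (simp add: uv arcs d_def)
      next
        case True
        with that uv have "b \<noteq> b'" by simp
        with cycle_dist_descent[OF m lt(2,4)] obtain w
          where "(b, w) \<in> parcs (cycle_graph m)" "cycle_dist m b b' = Suc (cycle_dist m w b')"
          by blast
        then show ?thesis using lt by (intro exI[of _ "(a, w)"]) (simp add: uv arcs d_def)
      qed
    qed
  qed (use assms in \<open>auto simp: verts d_def\<close>)
  then show ?thesis by (simp add: d_def)
qed

section \<open>Orthogonality of the Hartley matrix\<close>

definition cas :: "real \<Rightarrow> real" where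
  "cas x = cos x + sin x"

lemma cas_mult: "cas x * cas y = cos (x - y) + sin (x + y)"
  by (simp add: cas_def cos_diff sin_add algebra_simps)

text \<open>Real and imaginary parts of the geometric sum over powers of \<open>z\<close>, where
  \<open>z ^ k = 1\<close>; it vanishes unless \<open>z = 1\<close>. The frequency \<open>j\<close>
  is an integer because differences of indices occur.\<close>

lemma sum_cos_sin_roots_of_unity:
  fixes j :: int
  assumes k: "k > 0"
  shows "(\<Sum>d<k. cos (2 * pi * real_of_int j / real k * real d)) = (if int k dvd j then real k else 0)"
    and "(\<Sum>d<k. sin (2 * pi * real_of_int j / real k * real d)) = 0"
proof -
  define t where "t = 2 * pi * real_of_int j / real k"
  define z where "z = cis t"
  have pow: "z ^ d = cis (t * real d)" for d
    by (simp add: z_def DeMoivre mult.commute)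
  have "z ^ k = cis (2 * pi * real_of_int j)"
    using k by (simp add: pow t_def)
  then have zk: "z ^ k = 1"
    by (simp add: complex_eq_iff cos_integer_2pi sin_integer_2pi)
  have z1: "z = 1 \<longleftrightarrow> int k dvd j"
  proof -
    have "z = 1 \<longleftrightarrow> cos t = 1"
      using cos_one_sin_zero[of t] by (auto simp: z_def complex_eq_iff)
    also have "\<dots> \<longleftrightarrow> (\<exists>n::int. t = n * 2 * pi)"
      by (rule cos_one_2pi_int)
    also have "\<dots> \<longleftrightarrow> (\<exists>n::int. real_of_int j = real_of_int (int k * n))"
      using k by (auto simp: t_def field_simps)
    also have "\<dots> \<longleftrightarrow> int k dvd j"
      unfolding of_int_eq_iff dvd_def ..
    finally show ?thesis .
  qed
  have S: "(\<Sum>d<k. z ^ d) = (if int k dvd j then of_nat k else 0)"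
  proof (cases "z = 1")
    case True
    then show ?thesis using z1 by simp
  next
    case False
    then show ?thesis using z1 zk power_diff_1_eq[of z k] by auto
  qed
  show "(\<Sum>d<k. cos (2 * pi * real_of_int j / real k * real d)) = (if int k dvd j then real k else 0)"
    using arg_cong[OF S, of Re] by (auto simp: pow t_def)
  show "(\<Sum>d<k. sin (2 * pi * real_of_int j / real k * real d)) = 0"
    using arg_cong[OF S, of Im] by (auto simp: pow t_def split: if_splits)
qed

definition hartley :: "nat \<Rightarrow> nat \<Rightarrow> nat \<Rightarrow> real" where
  "hartley k u v = cas (2 * pi * real u * real v / real k)"

lemma hartley_0 [simp]: "hartley k u 0 = 1" "hartley k 0 v = 1"
  by (simp_all add: hartley_def cas_def)

text \<open>By \<open>cas_mult\<close> each product is a cosine of frequency \<open>u - v\<close>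
  plus a sine of frequency \<open>u + v\<close>. The sines always sum to \<open>0\<close>; the
  cosines do so unless \<open>k\<close> divides \<open>u - v\<close>, which for indices below
  \<open>k\<close> means \<open>u = v\<close>.\<close>

lemma hartley_orthogonal:
  assumes "u < k" "v < k"
  shows "(\<Sum>w<k. hartley k u w * hartley k w v) = (if u = v then real k else 0)"
proof -
  have k: "k > 0" using assms by simp
  have eq: "hartley k u w * hartley k w v =
      cos (2 * pi * real_of_int (int u - int v) / real k * real w) +
      sin (2 * pi * real_of_int (int u + int v) / real k * real w)" for w
    unfolding hartley_def cas_mult
    by (intro arg_cong2[where f = "(+)"] arg_cong[where f = cos] arg_cong[where f = sin])
      (simp_all add: add_divide_distrib diff_divide_distrib algebra_simps)
  have "int k dvd int u - int v \<longleftrightarrow> u = v"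
    using assms dvd_imp_le_int[of "int u - int v" "int k"] by (cases u v rule: linorder_cases) auto
  then show ?thesis
    unfolding eq sum.distrib sum_cos_sin_roots_of_unity[OF k] by simp
qed

text \<open>Orthogonality to the constant row \<open>0\<close>: this is how \<open>J\<close>
  annihilates the other columns.\<close>

lemma sum_hartley:
  assumes "v < k"
  shows "(\<Sum>w<k. hartley k w v) = (if v = 0 then real k else 0)"
  using hartley_orthogonal[of 0 k v] assms by auto

section \<open>Distance eigenvalues of an odd cycle\<close>

text \<open>The cosine transform of the distances from vertex \<open>0\<close>, i.e. of the first
  row of the circulant distance matrix.\<close>

definition cycle_eigenvalue :: "nat \<Rightarrow> nat \<Rightarrow> real" where
  "cycle_eigenvalue k v = (\<Sum>d<k. real (min d (k - d)) * cos (2 * pi * real v / real k * real d))"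

text \<open>After the shift \<open>w = u + d\<close> modulo \<open>k\<close> the distance depends on
  \<open>d\<close> alone. The addition formulas split off a cosine sum, which is the eigenvalue, and
  a sine sum, which vanishes by the symmetry between \<open>d\<close> and
  \<open>k - d\<close>.\<close>

lemma cycle_dist_eigenvector:
  assumes u: "u < k"
  shows "(\<Sum>w<k. real (cycle_dist k u w) * hartley k w v) = cycle_eigenvalue k v * hartley k u v"
proof -
  define \<theta> where "\<theta> = 2 * pi * real v / real k"
  define f where "f d = real (min d (k - d))" for d
  have k: "k > 0" using u by simp
  have \<theta>k: "\<theta> * real k = 2 * pi * real v" using k by (simp add: \<theta>_def)
  \<comment> \<open>All sums reduced below are less than \<open>2 * k\<close>, so one subtraction
    suffices.\<close>
  have mod: "x mod k = (if x < k then x else x - k)" if "x < 2 * k" for x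
    using that by (simp add: mod_if)
  have "bij_betw (\<lambda>d. (u + d) mod k) {..<k} {..<k}"
  proof (rule bij_betwI[where g = "\<lambda>w. (w + (k - u)) mod k"])
    show "((u + d) mod k + (k - u)) mod k = d" if "d \<in> {..<k}" for d
      using that u by (simp add: mod split: if_split)
    show "(u + (w + (k - u)) mod k) mod k = w" if "w \<in> {..<k}" for w
      using that u by (simp add: mod split: if_split)
  qed (use k in auto)
  then have "(\<Sum>w<k. real (cycle_dist k u w) * hartley k w v) =
      (\<Sum>d<k. real (cycle_dist k u ((u + d) mod k)) * hartley k ((u + d) mod k) v)"
    by (simp add: sum.reindex_bij_betw[where g = "\<lambda>w. real (cycle_dist k u w) * hartley k w v"])
  also have "\<dots> = (\<Sum>d<k. f d * cas (\<theta> * u + \<theta> * d))"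
  proof (rule sum.cong[OF refl])
    fix d assume d: "d \<in> {..<k}"
    have "cycle_dist k u ((u + d) mod k) = min d (k - d)"
      using d u by (auto simp: mod cycle_dist_le min_def)
    moreover have "hartley k ((u + d) mod k) v = cas (\<theta> * u + \<theta> * d)"
    proof (cases "u + d < k")
      case True
      then show ?thesis by (simp add: hartley_def \<theta>_def field_simps)
    next
      case False
      then have "(u + d) mod k = u + d - k" using u d by (simp add: mod_if)
      \<comment> \<open>Wrapping around changes the angle by a whole number \<open>v\<close> of full
        turns.\<close>
      moreover have "2 * pi * real (u + d - k) * real v / real k =
          \<theta> * u + \<theta> * d - 2 * real v * pi"
        using False k by (simp add: \<theta>_def of_nat_diff field_simps)
      ultimately show ?thesis
        unfolding hartley_def cas_def
        by (simp add: cos_diff sin_diff sin_2npi cos_2npi)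
    qed
    ultimately show "real (cycle_dist k u ((u + d) mod k)) * hartley k ((u + d) mod k) v =
        f d * cas (\<theta> * u + \<theta> * d)"
      by (simp add: f_def)
  qed
  also have "\<dots> = (\<Sum>d<k. f d * cos (\<theta> * d)) * cas (\<theta> * u) +
      (\<Sum>d<k. f d * sin (\<theta> * d)) * (cos (\<theta> * u) - sin (\<theta> * u))"
    unfolding sum_distrib_right sum.distrib[symmetric]
    by (intro sum.cong) (simp_all add: cas_def cos_add sin_add algebra_simps)
  also have "(\<Sum>d<k. f d * sin (\<theta> * d)) = 0"
  proof -
    \<comment> \<open>Reflection fixes \<open>f\<close> and negates the sine, so the sum is its own
      negative. Index \<open>0\<close> is set aside because its mirror image \<open>k\<close> is out
      of range; its term is \<open>0\<close>.\<close>
    have "(\<Sum>d\<in>{1..<k}. f d * sin (\<theta> * d)) = (\<Sum>d\<in>{1..<k}. f (k - d) * sin (\<theta> * (k - d)))"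
      by (rule sum.reindex_bij_witness[of _ "\<lambda>d. k - d" "\<lambda>d. k - d"]) auto
    also have "\<dots> = (\<Sum>d\<in>{1..<k}. - (f d * sin (\<theta> * d)))"
    proof (rule sum.cong[OF refl])
      fix d assume d: "d \<in> {1..<k}"
      then have "\<theta> * real (k - d) = 2 * real v * pi - \<theta> * d"
        using \<theta>k by (simp add: of_nat_diff algebra_simps)
      then have "sin (\<theta> * real (k - d)) = - sin (\<theta> * d)"
        by (simp add: sin_diff sin_2npi cos_2npi)
      moreover have "f (k - d) = f d"
        using d by (auto simp: f_def min_def)
      ultimately show "f (k - d) * sin (\<theta> * real (k - d)) = - (f d * sin (\<theta> * d))"
        by simp
    qed
    finally have "(\<Sum>d\<in>{1..<k}. f d * sin (\<theta> * d)) = 0"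
      by (simp add: sum_negf)
    moreover have "{..<k} = insert 0 {1..<k}" using k by auto
    ultimately show ?thesis by simp
  qed
  finally show ?thesis
    by (simp add: cycle_eigenvalue_def hartley_def f_def \<theta>_def field_simps)
qed

text \<open>Summation by induction; the step is the second-difference identity for the cosine,
  labelled \<open>*\<close>. Keeping the factor \<open>4 * (sin \<phi>)\<^sup>2\<close> on the left
  avoids a division.\<close>

lemma sum_multiples_cos:
  fixes \<phi> :: real
  shows "4 * (sin \<phi>)\<^sup>2 * (\<Sum>d=1..n. real d * cos (2 * \<phi> * real d)) =
    (real n + 1) * cos (2 * \<phi> * real n) - real n * cos (2 * \<phi> * (real n + 1)) - 1"
proof (induction n)
  case (Suc n)
  define x where "x = 2 * \<phi> * (real n + 1)"
  have *: "cos (x + 2 * \<phi>) + cos (x - 2 * \<phi>) = 2 * cos x * (1 - 2 * (sin \<phi>)\<^sup>2)"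
    by (simp add: cos_add cos_diff cos_double_sin)
  have **: "2 * \<phi> * real n = x - 2 * \<phi>" "2 * \<phi> * real (Suc n) = x" "2 * \<phi> * (real (Suc n) + 1) = x + 2 * \<phi>"
    by (simp_all add: x_def algebra_simps)
  have "4 * (sin \<phi>)\<^sup>2 * (\<Sum>d=1..Suc n. real d * cos (2 * \<phi> * real d)) =
      (real n + 1) * cos (x - 2 * \<phi>) - real n * cos x - 1 + 4 * (sin \<phi>)\<^sup>2 * ((real n + 1) * cos x)"
    using Suc by (simp add: distrib_left ** x_def[symmetric] del: of_nat_Suc)
  also have "\<dots> = (real (Suc n) + 1) * cos x - real (Suc n) * cos (x + 2 * \<phi>) - 1"
  proof -
    have "cos (x - 2 * \<phi>) = 2 * cos x * (1 - 2 * (sin \<phi>)\<^sup>2) - cos (x + 2 * \<phi>)"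
      using * by simp
    then show ?thesis by (simp only:) (simp add: algebra_simps)
  qed
  finally show ?case by (simp only: **)
qed simp

text \<open>For odd \<open>k\<close> no vertex is antipodal to \<open>0\<close>, so the nonzero
  indices pair off as \<open>d\<close> and \<open>k - d\<close> with equal terms.\<close>

lemma cycle_eigenvalue_half:
  assumes k: "k = 2 * n + 1"
  shows "cycle_eigenvalue k v = 2 * (\<Sum>d=1..n. real d * cos (2 * pi * real v / real k * real d))"
proof -
  define \<theta> where "\<theta> = 2 * pi * real v / real k"
  define g where "g d = real (min d (k - d)) * cos (\<theta> * real d)" for d
  have "{..<k} = {0} \<union> {1..n} \<union> {n+1..2*n}" using k by auto
  then have "sum g {..<k} = sum g ({0} \<union> {1..n}) + sum g {n+1..2*n}"
    by (simp only:) (rule sum.union_disjoint; auto)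
  also have "sum g ({0} \<union> {1..n}) = sum g {1..n}"
    by (simp add: g_def)
  also have "sum g {n+1..2*n} = sum g {1..n}"
  proof (rule sum.reindex_bij_witness[of _ "\<lambda>d. k - d" "\<lambda>d. k - d"])
    fix d assume d: "d \<in> {n+1..2*n}"
    then have "\<theta> * real (k - d) = 2 * real v * pi - \<theta> * d"
      using k by (simp add: \<theta>_def field_simps)
    then have "cos (\<theta> * real (k - d)) = cos (\<theta> * d)"
      by (simp add: cos_diff sin_2npi cos_2npi)
    then show "g (k - d) = g d" using d k by (simp add: g_def min_def)
  qed (use k in auto)
  also have "sum g {1..n} = (\<Sum>d=1..n. real d * cos (\<theta> * real d))"
    using k by (intro sum.cong) (auto simp: g_def)
  finally show ?thesis by (simp add: cycle_eigenvalue_def g_def \<theta>_def)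
qed

lemma cycle_eigenvalue_0:
  assumes "odd k"
  shows "cycle_eigenvalue k 0 = ((real k)\<^sup>2 - 1) / 4"
proof -
  obtain n where k: "k = 2 * n + 1" using assms by (rule oddE)
  have "2 * (\<Sum>d=1..n. real d) = real n * (real n + 1)"
    by (induction n) (auto simp: algebra_simps)
  then show ?thesis
    unfolding cycle_eigenvalue_half[OF k] by (simp add: k power2_eq_square algebra_simps)
qed

text \<open>With \<open>\<psi>\<close> the angle of the claim, the closed form applies at
  \<open>\<phi> = 2 * \<psi>\<close>. Its right side collapses to
  \<open>(-1) ^ v * cos (2 * \<psi>) - 1\<close>, which is minus twice a squared sine
  (\<open>v\<close> even) or cosine (\<open>v\<close> odd) of \<open>\<psi>\<close>. This cancels
  one factor of \<open>(sin (2 * \<psi>))\<^sup>2\<close> and leaves the other in the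
  denominator.\<close>

lemma cycle_eigenvalue_nonzero:
  assumes "odd k" "0 < v" "v < k"
  shows "cycle_eigenvalue k v = (if even v
    then - (sec (pi * real v / (2 * real k)))\<^sup>2 / 4
    else - (csc (pi * real v / (2 * real k)))\<^sup>2 / 4)"
proof -
  obtain n where k: "k = 2 * n + 1" using assms(1) by (rule oddE)
  define \<psi> where "\<psi> = pi * real v / (2 * real k)"
  have k0: "real k > 0" using k by simp
  have "real v < real k" using assms by simp
  then have \<psi>: "0 < \<psi>" "\<psi> < pi / 2"
    using assms k0 by (auto simp: \<psi>_def field_simps)
  then have nz: "sin \<psi> \<noteq> 0" "cos \<psi> \<noteq> 0"
    using sin_gt_zero[of \<psi>] cos_gt_zero[of \<psi>] pi_gt_zero by linarith+
  define S where "S = (\<Sum>d=1..n. real d * cos (2 * (2 * \<psi>) * real d))"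
  have lam: "cycle_eigenvalue k v = 2 * S"
    by (simp add: cycle_eigenvalue_half[OF k] S_def \<psi>_def field_simps)
  \<comment> \<open>Here \<open>2 * n = k - 1\<close> and \<open>2 * (n + 1) = k + 1\<close> place
    both angles symmetrically about \<open>pi * v\<close>.\<close>
  have ang: "2 * (2 * \<psi>) * real n = pi * real v - 2 * \<psi>" "2 * (2 * \<psi>) * (real n + 1) = pi * real v + 2 * \<psi>"
    using k0 by (simp_all add: \<psi>_def k field_simps)
  have "4 * (sin (2 * \<psi>))\<^sup>2 * S = (-1) ^ v * cos (2 * \<psi>) - 1"
    unfolding S_def sum_multiples_cos ang
    by (simp add: cos_add cos_diff cos_npi2 sin_npi2 algebra_simps)
  then have eq: "16 * (sin \<psi>)\<^sup>2 * (cos \<psi>)\<^sup>2 * S = (-1) ^ v * cos (2 * \<psi>) - 1"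
    unfolding sin_double by (simp add: power_mult_distrib mult_ac)
  \<comment> \<open>Stated for arbitrary \<open>s\<close> and \<open>c\<close> since the squared
    sine and cosine swap roles with the parity of \<open>v\<close>.\<close>
  have cancel: "S = - 1 / (8 * c)" if "16 * s * c * S = - 2 * s" "s \<noteq> 0" "c \<noteq> 0" for s c
  proof -
    have "s * (8 * c * S) = s * - 1" using that(1) by (simp add: mult_ac)
    then have "8 * c * S = - 1" using that(2) mult_left_cancel by blast
    then show ?thesis using that(3) by (simp add: field_simps)
  qed
  show ?thesis
  proof (cases "even v")
    case True
    then have "16 * (sin \<psi>)\<^sup>2 * (cos \<psi>)\<^sup>2 * S = - 2 * (sin \<psi>)\<^sup>2"
      unfolding eq cos_double_sin by simp
    then have "S = - 1 / (8 * (cos \<psi>)\<^sup>2)" by (rule cancel) (use nz in simp_all)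
    then show ?thesis
      using True by (simp add: lam sec_def \<psi>_def[symmetric] power_divide)
  next
    case False
    then have "16 * (sin \<psi>)\<^sup>2 * (cos \<psi>)\<^sup>2 * S = - 2 * (cos \<psi>)\<^sup>2"
      unfolding eq cos_double_cos by simp
    then have "16 * (cos \<psi>)\<^sup>2 * (sin \<psi>)\<^sup>2 * S = - 2 * (cos \<psi>)\<^sup>2"
      by (simp only: mult.assoc mult.left_commute)
    then have "S = - 1 / (8 * (sin \<psi>)\<^sup>2)" by (rule cancel) (use nz in simp_all)
    then show ?thesis
      using False by (simp add: lam csc_def \<psi>_def[symmetric] power_divide)
  qed
qed

section \<open>Eigenvectors and spectrum of the nanotorus\<close>

text \<open>Eigenvalues of the plain distance matrix. A summand survives only if the column in the
  other factor is constant, where \<open>J\<close> acts as the order of that factor; at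
  \<open>(0, 0)\<close> both survive.\<close>

definition nanotorus_eigenvalue :: "nat \<Rightarrow> nat \<Rightarrow> nat \<times> nat \<Rightarrow> real" where
  "nanotorus_eigenvalue k m v =
    (if snd v = 0 then real m * cycle_eigenvalue k (fst v) else 0) +
    (if fst v = 0 then real k * cycle_eigenvalue m (snd v) else 0)"

definition nanotorus_basis :: "nat \<Rightarrow> nat \<Rightarrow> nat \<times> nat \<Rightarrow> nat \<times> nat \<Rightarrow> real" where
  "nanotorus_basis k m u v = hartley k (fst u) (fst v) * hartley m (snd u) (snd v)"

lemma verts_nanotorus: "pverts (c4_nanotorus k m) = {..<k} \<times> {..<m}"
  by (simp add: c4_nanotorus_def cartesian_product_def cycle_graph_def atLeast0LessThan)

lemma nanotorus_basis_orthogonal: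
  assumes "u \<in> pverts (c4_nanotorus k m)" "v \<in> pverts (c4_nanotorus k m)"
  shows "(\<Sum>w\<in>pverts (c4_nanotorus k m). nanotorus_basis k m u w * nanotorus_basis k m w v) =
    (if u = v then real (k * m) else 0)"
proof -
  obtain a b a' b' where uv: "u = (a, b)" "v = (a', b')" by fastforce
  have lt: "a < k" "b < m" "a' < k" "b' < m" using assms by (auto simp: uv verts_nanotorus)
  have "(\<Sum>w\<in>pverts (c4_nanotorus k m). nanotorus_basis k m u w * nanotorus_basis k m w v) =
      (\<Sum>x<k. hartley k a x * hartley k x a') * (\<Sum>y<m. hartley m b y * hartley m y b')"
    by (simp add: verts_nanotorus uv nanotorus_basis_def sum_product sum.cartesian_product
        case_prod_beta mult_ac)
  then show ?thesis
    using lt by (simp add: hartley_orthogonal uv)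
qed

lemma nanotorus_eigenvector:
  assumes k: "k \<ge> 3" and m: "m \<ge> 3"
    and uv: "u \<in> pverts (c4_nanotorus k m)" "v \<in> pverts (c4_nanotorus k m)"
  shows "(\<Sum>w\<in>pverts (c4_nanotorus k m). graph_dist (c4_nanotorus k m) u w * nanotorus_basis k m w v) =
    nanotorus_eigenvalue k m v * nanotorus_basis k m u v"
proof -
  obtain a b a' b' where ab: "u = (a, b)" "v = (a', b')" by fastforce
  have lt: "a < k" "b < m" "a' < k" "b' < m" using uv by (auto simp: ab verts_nanotorus)
  have "(\<Sum>w\<in>pverts (c4_nanotorus k m). graph_dist (c4_nanotorus k m) u w * nanotorus_basis k m w v) =
      (\<Sum>(x, y)\<in>{..<k} \<times> {..<m}. real (cycle_dist k a x) * hartley k x a' * hartley m y b' +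
        hartley k x a' * (real (cycle_dist m b y) * hartley m y b'))"
    unfolding verts_nanotorus using lt
    by (intro sum.cong) (auto simp: ab graph_dist_nanotorus[OF k m] nanotorus_basis_def algebra_simps)
  also have "\<dots> = (\<Sum>x<k. real (cycle_dist k a x) * hartley k x a') * (\<Sum>y<m. hartley m y b') +
      (\<Sum>x<k. hartley k x a') * (\<Sum>y<m. real (cycle_dist m b y) * hartley m y b')"
    by (simp add: sum_product sum.cartesian_product case_prod_beta sum.distrib)
  also have "\<dots> = nanotorus_eigenvalue k m v * nanotorus_basis k m u v"
    using lt by (simp add: cycle_dist_eigenvector sum_hartley ab nanotorus_basis_def nanotorus_eigenvalue_def)
  finally show ?thesis .
qed

text \<open>The basis vector with index \<open>(0, 0)\<close> is the all-ones vector, so its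
  eigenvalue is every row sum.\<close>

lemma transmission_nanotorus:
  assumes "k \<ge> 3" "m \<ge> 3" "u \<in> pverts (c4_nanotorus k m)"
  shows "transmission (c4_nanotorus k m) u = nanotorus_eigenvalue k m (0, 0)"
proof -
  have "(0, 0) \<in> pverts (c4_nanotorus k m)"
    using assms by (simp add: verts_nanotorus)
  from nanotorus_eigenvector[OF assms this] show ?thesis
    by (simp add: transmission_def nanotorus_basis_def)
qed

text \<open>As the transmission is constant, the matrix is a multiple of the identity plus
  \<open>(1 - \<alpha>)\<close> times the distance matrix, with the same eigenvectors.\<close>

lemma gen_distance_spectrum_nanotorus:
  assumes k: "k \<ge> 3" and m: "m \<ge> 3"
    and vs: "distinct vs" "set vs = pverts (c4_nanotorus k m)"
  shows "gen_distance_spectrum \<alpha> (c4_nanotorus k m) vs =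
    image_mset (\<lambda>v. \<alpha> * nanotorus_eigenvalue k m (0, 0) + (1 - \<alpha>) * nanotorus_eigenvalue k m v)
      (mset_set ({..<k} \<times> {..<m}))"
proof -
  define G where "G = c4_nanotorus k m"
  \<comment> \<open>The constant transmission is already inserted, so \<open>A\<close> gives the
    matrix entries only at vertices of the graph.\<close>
  define A where "A u w = (if u = w then \<alpha> * nanotorus_eigenvalue k m (0, 0) else 0) +
    (1 - \<alpha>) * graph_dist G u w" for u w
  have "gen_distance_mat \<alpha> G vs = mat (length vs) (length vs) (\<lambda>(i, j). A (vs ! i) (vs ! j))"
  proof (rule eq_matI)
    fix i j
    assume "i < dim_row (mat (length vs) (length vs) (\<lambda>(i, j). A (vs ! i) (vs ! j)))"
      "j < dim_col (mat (length vs) (length vs) (\<lambda>(i, j). A (vs ! i) (vs ! j)))"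
    then have ij: "i < length vs" "j < length vs" by simp_all
    then have "vs ! i \<in> pverts G" "vs ! j \<in> pverts G" using vs(2) by (auto simp: G_def dest: nth_mem)
    then show "gen_distance_mat \<alpha> G vs $$ (i, j) =
        mat (length vs) (length vs) (\<lambda>(i, j). A (vs ! i) (vs ! j)) $$ (i, j)"
      using ij vs(1) transmission_nanotorus[OF k m]
      by (simp add: gen_distance_mat_def transmission_mat_def distance_mat_def A_def G_def
          nth_eq_iff_index_eq)
  qed (simp_all add: gen_distance_mat_def transmission_mat_def distance_mat_def)
  moreover have "proots (char_poly (mat (length vs) (length vs) (\<lambda>(i, j). A (vs ! i) (vs ! j)))) =
    image_mset (\<lambda>v. \<alpha> * nanotorus_eigenvalue k m (0, 0) + (1 - \<alpha>) * nanotorus_eigenvalue k m v)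
      (mset_set (set vs))"
  proof (rule proots_char_poly_eqI[where P = "nanotorus_basis k m" and c = "real (k * m)"])
    fix u v assume uv: "u \<in> set vs" "v \<in> set vs"
    have "(\<Sum>w\<in>set vs. A u w * nanotorus_basis k m w v) =
        (\<Sum>w\<in>set vs. (if w = u then \<alpha> * nanotorus_eigenvalue k m (0, 0) * nanotorus_basis k m w v else 0)) +
        (1 - \<alpha>) * (\<Sum>w\<in>set vs. graph_dist G u w * nanotorus_basis k m w v)"
      unfolding sum_distrib_left sum.distrib[symmetric]
      by (intro sum.cong) (auto simp: A_def algebra_simps)
    also have "\<dots> = (\<alpha> * nanotorus_eigenvalue k m (0, 0) + (1 - \<alpha>) * nanotorus_eigenvalue k m v) *
        nanotorus_basis k m u v"
      using uv nanotorus_eigenvector[OF k m, of u v] vs verts_nanotorus[of k m]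
      by (subst sum.delta) (simp_all add: G_def algebra_simps)
    finally show "(\<Sum>w\<in>set vs. A u w * nanotorus_basis k m w v) =
        (\<alpha> * nanotorus_eigenvalue k m (0, 0) + (1 - \<alpha>) * nanotorus_eigenvalue k m v) *
        nanotorus_basis k m u v" .
  qed (use k m vs nanotorus_basis_orthogonal in auto)
  ultimately show ?thesis
    by (simp add: gen_distance_spectrum_def G_def vs(2) verts_nanotorus)
qed

section \<open>Sorting the eigenvalues into six families\<close>

text \<open>The origin, each axis without the origin split by parity, and the interior: one disjoint
  piece for each family of eigenvalues, in the order of the theorem.\<close>

lemma mset_set_grid_split:
  fixes k m :: nat
  assumes "k > 0" "m > 0"
  shows "mset_set ({..<k} \<times> {..<m}) = {#(0, 0)#}
    + {#(j, 0). j \<in># mset_set {j \<in> {1..k - 1}. even j}#}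
    + {#(j, 0). j \<in># mset_set {j \<in> {1..k - 1}. odd j}#}
    + {#(0, t). t \<in># mset_set {t \<in> {1..m - 1}. even t}#}
    + {#(0, t). t \<in># mset_set {t \<in> {1..m - 1}. odd t}#}
    + mset_set ({1..k - 1} \<times> {1..m - 1})"
proof -
  define A where "A = {(0 :: nat, 0 :: nat)}"
  define B where "B = (\<lambda>j. (j, 0 :: nat)) ` {j \<in> {1..k - 1}. even j}"
  define C where "C = (\<lambda>j. (j, 0 :: nat)) ` {j \<in> {1..k - 1}. odd j}"
  define D where "D = (\<lambda>t. (0 :: nat, t)) ` {t \<in> {1..m - 1}. even t}"
  define E where "E = (\<lambda>t. (0 :: nat, t)) ` {t \<in> {1..m - 1}. odd t}"
  define F where "F = {1..k - 1} \<times> {1..m - 1}"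
  note defs = A_def B_def C_def D_def E_def F_def
  have grid: "{..<k} \<times> {..<m} = A \<union> B \<union> C \<union> D \<union> E \<union> F"
    using assms by (auto simp: defs image_iff)
  have fin: "finite A" "finite B" "finite C" "finite D" "finite E" "finite F"
    by (simp_all add: defs)
  have disj: "A \<inter> B = {}" "(A \<union> B) \<inter> C = {}" "(A \<union> B \<union> C) \<inter> D = {}"
    "(A \<union> B \<union> C \<union> D) \<inter> E = {}" "(A \<union> B \<union> C \<union> D \<union> E) \<inter> F = {}"
    by (auto simp: defs)
  have inj: "inj_on (\<lambda>j. (j, 0 :: nat)) S" "inj_on (\<lambda>t. (0 :: nat, t)) S" for S :: "nat set"
    by (auto simp: inj_on_def)
  have "mset_set ({..<k} \<times> {..<m}) =
      mset_set A + mset_set B + mset_set C + mset_set D + mset_set E + mset_set F"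
    unfolding grid by (simp only: mset_set_Union fin disj finite_Un simp_thms)
  then show ?thesis
    by (simp only: defs image_mset_mset_set[OF inj(1)] image_mset_mset_set[OF inj(2)])
      simp
qed

theorem theorem5p3:
  fixes k m :: nat and \<alpha> :: real and vs :: "(nat \<times> nat) list"
  assumes "k \<ge> 3" and "odd k"
    and "m \<ge> 3" and "odd m"
    and "0 \<le> \<alpha>" and "\<alpha> \<le> 1"
    and "distinct vs" and "set vs = pverts (c4_nanotorus k m)"
  shows "gen_distance_spectrum \<alpha> (c4_nanotorus k m) vs =
      {# (real m + real k) * (real m * real k - 1) / 4 #}
    + {# - (real m * (1 - \<alpha>) / 4) * (sec (pi * real j / (2 * real k)))\<^sup>2
           + \<alpha> * (real m + real k) * (real m * real k - 1) / 4.
         j \<in># mset_set {j \<in> {1..k - 1}. even j} #}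
    + {# - (real m * (1 - \<alpha>) / 4) * (csc (pi * real r / (2 * real k)))\<^sup>2
           + \<alpha> * (real m + real k) * (real m * real k - 1) / 4.
         r \<in># mset_set {r \<in> {1..k - 1}. odd r} #}
    + {# - (real k * (1 - \<alpha>) / 4) * (sec (pi * real t / (2 * real m)))\<^sup>2
           + \<alpha> * (real m + real k) * (real m * real k - 1) / 4.
         t \<in># mset_set {t \<in> {1..m - 1}. even t} #}
    + {# - (real k * (1 - \<alpha>) / 4) * (csc (pi * real l / (2 * real m)))\<^sup>2
           + \<alpha> * (real m + real k) * (real m * real k - 1) / 4.
         l \<in># mset_set {l \<in> {1..m - 1}. odd l} #}
    + replicate_mset ((k - 1) * (m - 1))
        (\<alpha> * (real m + real k) * (real m * real k - 1) / 4)"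
proof -
  define T where "T = (real m + real k) * (real m * real k - 1) / 4"
  define f where "f v = \<alpha> * nanotorus_eigenvalue k m (0, 0) + (1 - \<alpha>) * nanotorus_eigenvalue k m v" for v
  have pos: "k > 0" "m > 0" using assms by simp_all
  \<comment> \<open>This is \<open>m * (k\<^sup>2 - 1) / 4 + k * (m\<^sup>2 - 1) / 4\<close>, which
    factors as \<open>T\<close>.\<close>
  have T0: "nanotorus_eigenvalue k m (0, 0) = T"
    using assms by (simp add: nanotorus_eigenvalue_def cycle_eigenvalue_0 T_def power2_eq_square field_simps)
  have f0: "f (0, 0) = T"
    by (simp add: f_def T0 algebra_simps)
  have fk: "f (j, 0) = - (real m * (1 - \<alpha>) / 4) *
      (if even j then sec (pi * real j / (2 * real k)) else csc (pi * real j / (2 * real k)))\<^sup>2 + \<alpha> * T"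
    if "j \<in> {1..k - 1}" for j
    unfolding f_def T0 using that assms
    by (auto simp: nanotorus_eigenvalue_def cycle_eigenvalue_nonzero)
  have fm: "f (0, t) = - (real k * (1 - \<alpha>) / 4) *
      (if even t then sec (pi * real t / (2 * real m)) else csc (pi * real t / (2 * real m)))\<^sup>2 + \<alpha> * T"
    if "t \<in> {1..m - 1}" for t
    unfolding f_def T0 using that assms
    by (auto simp: nanotorus_eigenvalue_def cycle_eigenvalue_nonzero)
  \<comment> \<open>In the interior neither column is constant, so the distance matrix contributes
    \<open>0\<close> and only the transmission remains.\<close>
  have "{#f v. v \<in># mset_set ({1..k - 1} \<times> {1..m - 1})#} =
      {#\<alpha> * T. v \<in># mset_set ({1..k - 1} \<times> {1..m - 1})#}"
    unfolding f_def T0 by (rule image_mset_cong) (auto simp: nanotorus_eigenvalue_def)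
  then have fkm: "{#f v. v \<in># mset_set ({1..k - 1} \<times> {1..m - 1})#} =
      replicate_mset ((k - 1) * (m - 1)) (\<alpha> * T)"
    by (simp add: image_mset_const_eq card_cartesian_product)
  have \<alpha>T: "\<alpha> * (real m + real k) * (real m * real k - 1) / 4 = \<alpha> * T"
    by (simp add: T_def)
  have spectrum: "gen_distance_spectrum \<alpha> (c4_nanotorus k m) vs = image_mset f (mset_set ({..<k} \<times> {..<m}))"
    unfolding f_def using assms by (intro gen_distance_spectrum_nanotorus)
  show ?thesis
    unfolding spectrum mset_set_grid_split[OF pos] image_mset_union \<alpha>T T_def[symmetric] fkm
      multiset.map_comp comp_def
    by (intro arg_cong2[where f = "(+)"] refl image_mset_cong) (simp_all add: f0 fk fm)
qed

end
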